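(* Let $U$ be a nonempty set. For every MSO formula $\varphi$, the following are equivalent: (i) for every interpretation $II$ over $U$ and all assignments $gg:V\to U$, $GG:V_2\to\mathcal P(U)$, the proposition $(\!|\varphi|\!)_{II,gg,GG}$ is true; (ii) for every interpretation $I$ over $U$ and all assignments $g:V\to U$, $G:V_2\to\mathcal P(U)$, $\langle I,\mathrm{Range}(g),\mathrm{Range}(G)\rangle,g,G\models^d\varphi$.
   Context: **Syntax.** Relation symbols $R=\mathbb N$, first-order variables $V=\mathbb N$ and second-order (monadic) variables $V_2=\mathbb N$ (the two kinds of variables form separate namespaces). MSO formulas: $\varphi,\psi ::= r(x,y)\mid X(x)\mid\neg\varphi\mid\varphi\wedge\psi\mid\exists x.\varphi\mid\exists X.\varphi$ with $r\in R$, $x,y\in V$, $X\in V_2$ (no equality). **Semantics.** $U$ is a fixed nonempty set (the type of individuals). An interpretation $I$ over $U$ assigns to each $r\in R$ a binary relation $I(r)\subseteq U\times U$. Given $I$, a set $D\subseteq U$, a family $E\subseteq\mathcal P(U)$ (no closure condition on $E$), and assignments $g:V\to U$, $G:V_2\to\mathcal P(U)$, truth $\langle I,D,E\rangle,g,G\models^d\varphi$ is defined recursively: $r(x,y)$ holds iff $(g(x),g(y))\in I(r)$; $X(x)$ holds iff $g(x)\in G(X)$; $\neg,\wedge$ are classical; $\exists x.\varphi$ holds iff $\langle I,D,E\rangle,g[x\leftarrow d],G\models^d\varphi$ for some $d\in D$; $\exists X.\varphi$ holds iff $\langle I,D,E\rangle,g,G\langle X\leftarrow S\rangle\models^d\varphi$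 for some $S\in E$. Here $g[x\leftarrow d]$ and $G\langle X\leftarrow S\rangle$ are the usual updates. **Safe substitution.** $[x\leftarrow_r z](\varphi)$ (for $x,z\in V$) is capture-avoiding substitution: first rename every binder $\exists z$ in $\varphi$, together with the occurrences it binds, to $\exists w$ for a fresh variable $w$ (say the least one not occurring in $\varphi$ and different from $x,z$), then replace all free occurrences of $x$ by $z$. $[X\leftarrow_{r2}Z](\varphi)$ for $X,Z\in V_2$ is the analogous operation for second-order variables. Binders of one namespace do not interact with substitution in the other. Both operations preserve formula size. **Minimal-shallow translation.** For parameters $II$ (an interpretation over $U$), $gg:V\to U$, $GG:V_2\to\mathcal P(U)$, the truth value $(\!|\varphi|\!)=(\!|\varphi|\!)_{II,gg,GG}$ is defined by recursion on formula size: $(\!|r(x,y)|\!)$ is $(gg(x),gg(y))\in II(r)$; $(\!|X(x)|\!)$ is $gg(x)\in GG(X)$; $(\!|\neg\varphi|\!)$ is $\neg(\!|\varphi|\!)$; $(\!|\varphi\wedge\psi|\!)$ is $(\!|\varphi|\!)\wedge(\!|\psi|\!)$; $(\!|\exists x.\varphi|\!)$ is "there is a variable $z\in V$ with $(\!|[x\leftarrow_r z](\varphi)|\!)$"; $(\!|\exists X.\varphi|\!)$ is "there is a variable $Z\in V_2$ with $(\!|[X\leftarrow_{r2}Z](\varphi)|\!)$". *)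

theory Defs
  imports Main
begin

type_synonym rsym = nat
type_synonym var = nat
type_synonym var2 = nat

datatype mso =
    Rel rsym var var
  | Mem var2 var  \<comment> \<open>\<open>Mem X x\<close> is the atom \<open>X(x)\<close>\<close>
  | Neg mso
  | Conj mso mso
  | Ex1 var mso
  | Ex2 var2 mso


text \<open>The set \<open>U\<close> of individuals is the (necessarily nonempty) type \<open>'u\<close>.\<close>

type_synonym 'u interp = "rsym \<Rightarrow> ('u \<times> 'u) set"

primrec deep ::
  "'u interp \<Rightarrow> 'u set \<Rightarrow> 'u set set \<Rightarrow> (var \<Rightarrow> 'u) \<Rightarrow> (var2 \<Rightarrow> 'u set) \<Rightarrow> mso \<Rightarrow> bool" where
  "deep I D E g G (Rel r x y) \<longleftrightarrow> (g x, g y) \<in> I r"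
| "deep I D E g G (Mem X x) \<longleftrightarrow> g x \<in> G X"
| "deep I D E g G (Neg \<phi>) \<longleftrightarrow> \<not> deep I D E g G \<phi>"
| "deep I D E g G (Conj \<phi> \<psi>) \<longleftrightarrow> deep I D E g G \<phi> \<and> deep I D E g G \<psi>"
| "deep I D E g G (Ex1 x \<phi>) \<longleftrightarrow> (\<exists>d\<in>D. deep I D E (g(x := d)) G \<phi>)"
| "deep I D E g G (Ex2 X \<phi>) \<longleftrightarrow> (\<exists>S\<in>E. deep I D E g (G(X := S)) \<phi>)"


text \<open>All variables occurring in a formula: free, bound, or at a binder.\<close>

primrec vars1 :: "mso \<Rightarrow> var set" where
  "vars1 (Rel r x y) = {x, y}"
| "vars1 (Mem X x) = {x}"
| "vars1 (Neg \<phi>) = vars1 \<phi>"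
| "vars1 (Conj \<phi> \<psi>) = vars1 \<phi> \<union> vars1 \<psi>"
| "vars1 (Ex1 x \<phi>) = insert x (vars1 \<phi>)"
| "vars1 (Ex2 X \<phi>) = vars1 \<phi>"

primrec vars2 :: "mso \<Rightarrow> var2 set" where
  "vars2 (Rel r x y) = {}"
| "vars2 (Mem X x) = {X}"
| "vars2 (Neg \<phi>) = vars2 \<phi>"
| "vars2 (Conj \<phi> \<psi>) = vars2 \<phi> \<union> vars2 \<psi>"
| "vars2 (Ex1 x \<phi>) = vars2 \<phi>"
| "vars2 (Ex2 X \<phi>) = insert X (vars2 \<phi>)"


text \<open>Replacement of the free occurrences of \<open>x\<close> by \<open>z\<close>, with no precaution against capture.\<close>

primrec repl1 :: "var \<Rightarrow> var \<Rightarrow> mso \<Rightarrow> mso" where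
  "repl1 x z (Rel r u v) = Rel r (if u = x then z else u) (if v = x then z else v)"
| "repl1 x z (Mem Y u) = Mem Y (if u = x then z else u)"
| "repl1 x z (Neg \<phi>) = Neg (repl1 x z \<phi>)"
| "repl1 x z (Conj \<phi> \<psi>) = Conj (repl1 x z \<phi>) (repl1 x z \<psi>)"
| "repl1 x z (Ex1 u \<phi>) = Ex1 u (if u = x then \<phi> else repl1 x z \<phi>)"
| "repl1 x z (Ex2 Y \<phi>) = Ex2 Y (repl1 x z \<phi>)"

primrec repl2 :: "var2 \<Rightarrow> var2 \<Rightarrow> mso \<Rightarrow> mso" where
  "repl2 X Z (Rel r u v) = Rel r u v"
| "repl2 X Z (Mem Y u) = Mem (if Y = X then Z else Y) u"
| "repl2 X Z (Neg \<phi>) = Neg (repl2 X Z \<phi>)"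
| "repl2 X Z (Conj \<phi> \<psi>) = Conj (repl2 X Z \<phi>) (repl2 X Z \<psi>)"
| "repl2 X Z (Ex1 u \<phi>) = Ex1 u (repl2 X Z \<phi>)"
| "repl2 X Z (Ex2 Y \<phi>) = Ex2 Y (if Y = X then \<phi> else repl2 X Z \<phi>)"


text \<open>
  Renaming of every binder of \<open>z\<close>, together with the occurrences it binds, to \<open>w\<close>, where \<open>w\<close> is
  meant to be fresh. Nested binders of \<open>z\<close> cause no capture: once the inner binder has been
  renamed, no free \<open>z\<close> is left in its scope.
\<close>

primrec rename1 :: "var \<Rightarrow> var \<Rightarrow> mso \<Rightarrow> mso" where
  "rename1 z w (Rel r u v) = Rel r u v"
| "rename1 z w (Mem Y u) = Mem Y u"
| "rename1 z w (Neg \<phi>) = Neg (rename1 z w \<phi>)"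
| "rename1 z w (Conj \<phi> \<psi>) = Conj (rename1 z w \<phi>) (rename1 z w \<psi>)"
| "rename1 z w (Ex1 u \<phi>) =
    (if u = z then Ex1 w (repl1 z w (rename1 z w \<phi>)) else Ex1 u (rename1 z w \<phi>))"
| "rename1 z w (Ex2 Y \<phi>) = Ex2 Y (rename1 z w \<phi>)"

primrec rename2 :: "var2 \<Rightarrow> var2 \<Rightarrow> mso \<Rightarrow> mso" where
  "rename2 Z W (Rel r u v) = Rel r u v"
| "rename2 Z W (Mem Y u) = Mem Y u"
| "rename2 Z W (Neg \<phi>) = Neg (rename2 Z W \<phi>)"
| "rename2 Z W (Conj \<phi> \<psi>) = Conj (rename2 Z W \<phi>) (rename2 Z W \<psi>)"
| "rename2 Z W (Ex1 u \<phi>) = Ex1 u (rename2 Z W \<phi>)"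
| "rename2 Z W (Ex2 Y \<phi>) =
    (if Y = Z then Ex2 W (repl2 Z W (rename2 Z W \<phi>)) else Ex2 Y (rename2 Z W \<phi>))"


definition fresh1 :: "var \<Rightarrow> var \<Rightarrow> mso \<Rightarrow> var" where
  "fresh1 x z \<phi> = (LEAST w. w \<notin> vars1 \<phi> \<and> w \<noteq> x \<and> w \<noteq> z)"

definition fresh2 :: "var2 \<Rightarrow> var2 \<Rightarrow> mso \<Rightarrow> var2" where
  "fresh2 X Z \<phi> = (LEAST W. W \<notin> vars2 \<phi> \<and> W \<noteq> X \<and> W \<noteq> Z)"

definition subst1 :: "var \<Rightarrow> var \<Rightarrow> mso \<Rightarrow> mso"
    (\<open>[_ \<leftarrow>\<^sub>r _]'(_')\<close> [0, 0, 0] 1000) where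
  "[x \<leftarrow>\<^sub>r z](\<phi>) = repl1 x z (rename1 z (fresh1 x z \<phi>) \<phi>)"

definition subst2 :: "var2 \<Rightarrow> var2 \<Rightarrow> mso \<Rightarrow> mso"
    (\<open>[_ \<leftarrow>\<^sub>r\<^sub>2 _]'(_')\<close> [0, 0, 0] 1000) where
  "[X \<leftarrow>\<^sub>r\<^sub>2 Z](\<phi>) = repl2 X Z (rename2 Z (fresh2 X Z \<phi>) \<phi>)"

lemma size_repl1 [simp]: "size (repl1 x z \<phi>) = size \<phi>"
  by (induction \<phi>) auto

lemma size_repl2 [simp]: "size (repl2 X Z \<phi>) = size \<phi>"
  by (induction \<phi>) auto

lemma size_rename1 [simp]: "size (rename1 z w \<phi>) = size \<phi>"
  by (induction \<phi>) auto

lemma size_rename2 [simp]: "size (rename2 Z W \<phi>) = size \<phi>"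
  by (induction \<phi>) auto

lemma size_subst1 [simp]: "size ([x \<leftarrow>\<^sub>r z](\<phi>)) = size \<phi>"
  by (simp add: subst1_def)

lemma size_subst2 [simp]: "size ([X \<leftarrow>\<^sub>r\<^sub>2 Z](\<phi>)) = size \<phi>"
  by (simp add: subst2_def)


text \<open>The minimal-shallow translation: quantifiers range over variables, not over individuals.\<close>

function shallow ::
  "'u interp \<Rightarrow> (var \<Rightarrow> 'u) \<Rightarrow> (var2 \<Rightarrow> 'u set) \<Rightarrow> mso \<Rightarrow> bool" where
  "shallow II gg GG (Rel r x y) \<longleftrightarrow> (gg x, gg y) \<in> II r"
| "shallow II gg GG (Mem X x) \<longleftrightarrow> gg x \<in> GG X"
| "shallow II gg GG (Neg \<phi>) \<longleftrightarrow> \<not> shallow II gg GG \<phi>"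
| "shallow II gg GG (Conj \<phi> \<psi>) \<longleftrightarrow> shallow II gg GG \<phi> \<and> shallow II gg GG \<psi>"
| "shallow II gg GG (Ex1 x \<phi>) \<longleftrightarrow> (\<exists>z. shallow II gg GG ([x \<leftarrow>\<^sub>r z](\<phi>)))"
| "shallow II gg GG (Ex2 X \<phi>) \<longleftrightarrow> (\<exists>Z. shallow II gg GG ([X \<leftarrow>\<^sub>r\<^sub>2 Z](\<phi>)))"
  by pat_completeness auto
termination
  by (relation "measure (\<lambda>(II, gg, GG, \<phi>). size \<phi>)") auto

end

(*
  The shallow translation at (II, gg, GG) agrees pointwise with the deep semantics whose domains are
  the ranges of gg and GG: by the substitution lemma, replacing x by z amounts to updating gg at x
  with gg z, and as z varies these values exhaust the range of gg (likewise for set variables).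
  Substitution keeps gg and GG, so the ranges stay fixed along the recursion.
*)
theory Submission
  imports Defs
begin

section \<open>First-order variables: substitution as an update of the assignment\<close>

text \<open>
  The side condition of the replacement lemma cannot be that \<open>z\<close> is not bound in the formula:
  renaming nested binders of \<open>z\<close> replaces \<open>z\<close> by \<open>w\<close> below binders of \<open>w\<close> that are already
  renamed. It suffices that \<open>x\<close> does not occur free in the scope of a binder of \<open>z\<close>, which is
  \<open>free_for1\<close> (\<open>free_for2\<close> for set variables).
\<close>

primrec fv1 :: "mso \<Rightarrow> nat set" where
  "fv1 (Rel r x y) = {x, y}"
| "fv1 (Mem X x) = {x}"
| "fv1 (Neg \<phi>) = fv1 \<phi>"
| "fv1 (Conj \<phi> \<psi>) = fv1 \<phi> \<union> fv1 \<psi>"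
| "fv1 (Ex1 u \<phi>) = fv1 \<phi> - {u}"
| "fv1 (Ex2 u \<phi>) = fv1 \<phi>"

primrec binders1 :: "mso \<Rightarrow> nat set" where
  "binders1 (Rel r x y) = {}"
| "binders1 (Mem X x) = {}"
| "binders1 (Neg \<phi>) = binders1 \<phi>"
| "binders1 (Conj \<phi> \<psi>) = binders1 \<phi> \<union> binders1 \<psi>"
| "binders1 (Ex1 u \<phi>) = insert u (binders1 \<phi>)"
| "binders1 (Ex2 u \<phi>) = binders1 \<phi>"

primrec free_for1 :: "nat \<Rightarrow> nat \<Rightarrow> mso \<Rightarrow> bool" where
  "free_for1 x z (Rel r u v) \<longleftrightarrow> True"
| "free_for1 x z (Mem X u) \<longleftrightarrow> True"
| "free_for1 x z (Neg \<phi>) \<longleftrightarrow> free_for1 x z \<phi>"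
| "free_for1 x z (Conj \<phi> \<psi>) \<longleftrightarrow> free_for1 x z \<phi> \<and> free_for1 x z \<psi>"
| "free_for1 x z (Ex1 u \<phi>) \<longleftrightarrow> u = x \<or> x \<notin> fv1 \<phi> \<or> u \<noteq> z \<and> free_for1 x z \<phi>"
| "free_for1 x z (Ex2 u \<phi>) \<longleftrightarrow> free_for1 x z \<phi>"

lemma finite_vars1: "finite (vars1 \<phi>)"
  by (induction \<phi>) auto

lemma fv1_subset_vars1: "fv1 \<phi> \<subseteq> vars1 \<phi>"
  by (induction \<phi>) auto

lemma fresh1: "fresh1 x z \<phi> \<notin> vars1 \<phi> \<and> fresh1 x z \<phi> \<noteq> x \<and> fresh1 x z \<phi> \<noteq> z"
proof -
  have "\<exists>w. w \<notin> vars1 \<phi> \<union> {x, z}"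
    by (rule ex_new_if_finite) (simp_all add: finite_vars1)
  then have "\<exists>w. w \<notin> vars1 \<phi> \<and> w \<noteq> x \<and> w \<noteq> z"
    by blast
  then show ?thesis
    unfolding fresh1_def by (rule LeastI_ex)
qed

lemma repl1_notin_fv: "x \<notin> fv1 \<phi> \<Longrightarrow> repl1 x z \<phi> = \<phi>"
  by (induction \<phi>) auto

lemma fv1_repl1_subset: "fv1 (repl1 x z \<phi>) \<subseteq> insert z (fv1 \<phi> - {x})"
  by (induction \<phi>) auto

lemma fv1_rename1_subset: "fv1 (rename1 z w \<phi>) \<subseteq> fv1 \<phi>"
proof (induction \<phi>)
  case (Ex1 u \<phi>)
  then show ?case
    using fv1_repl1_subset[of z w "rename1 z w \<phi>"] by auto
qed auto

lemma binders1_repl1 [simp]: "binders1 (repl1 x z \<phi>) = binders1 \<phi>"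
  by (induction \<phi>) auto

lemma notin_binders1_rename1: "z \<noteq> w \<Longrightarrow> z \<notin> binders1 (rename1 z w \<phi>)"
  by (induction \<phi>) auto

lemma free_for1_if_notin_binders: "z \<notin> binders1 \<phi> \<Longrightarrow> free_for1 x z \<phi>"
  by (induction \<phi>) auto

text \<open>A binder of \<open>z\<close> becomes a binder of \<open>w\<close>, but the replacement
  below it removes every free \<open>z\<close> from its scope. Any other binder keeps its variable,
  which differs from \<open>w\<close> by freshness.\<close>

lemma free_for1_rename1: "w \<notin> vars1 \<phi> \<Longrightarrow> w \<noteq> z \<Longrightarrow> free_for1 z w (rename1 z w \<phi>)"
proof (induction \<phi>)
  case (Ex1 u \<phi>)
  then show ?case
    using fv1_repl1_subset[of z w "rename1 z w \<phi>"] by auto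
qed auto

lemma deep_cong1: "(\<And>v. v \<in> fv1 \<phi> \<Longrightarrow> g v = g' v) \<Longrightarrow> deep I D E g G \<phi> \<longleftrightarrow>
    deep I D E g' G \<phi>"
proof (induction \<phi> arbitrary: g g' G)
  case (Ex1 u \<phi>)
  have "deep I D E (g(u := d)) G \<phi> \<longleftrightarrow> deep I D E (g'(u := d)) G \<phi>" for d
    using Ex1.prems by (intro Ex1.IH) auto
  then show ?case by simp
next
  case (Ex2 u \<phi>)
  have "deep I D E g (G(u := d)) \<phi> \<longleftrightarrow> deep I D E g' (G(u := d)) \<phi>" for d
    using Ex2.prems by (intro Ex2.IH) auto
  then show ?case by simp
next
  case (Conj \<phi> \<psi>)
  then show ?case by (metis UnCI deep.simps(4) fv1.simps(4))
next
  case (Neg \<phi>)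
  then show ?case by (metis deep.simps(3) fv1.simps(3))
qed auto

lemma deep_repl1:
  "free_for1 x z \<phi> \<Longrightarrow> deep I D E g G (repl1 x z \<phi>) \<longleftrightarrow> deep I D E (g(x := g z)) G \<phi>"
proof (induction \<phi> arbitrary: g G)
  case (Ex1 u \<phi>)
  have "deep I D E (g(u := d)) G (if u = x then \<phi> else repl1 x z \<phi>) \<longleftrightarrow>
      deep I D E (g(x := g z, u := d)) G \<phi>" for d
  \<comment> \<open>In the first case the body is left unchanged, and the update at \<open>x\<close>
    is either overwritten by the one at \<open>u\<close> or never read. In the second case
    \<open>free_for1\<close> yields \<open>u \<noteq> z\<close>, so \<open>z\<close> keeps its value
    under the update at \<open>u\<close> and the two updates commute.\<close>
  proof (cases "u = x \<or> x \<notin> fv1 \<phi>")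
    case True
    then have "(if u = x then \<phi> else repl1 x z \<phi>) = \<phi>"
      by (auto simp: repl1_notin_fv)
    then show ?thesis
      using True by (simp only:) (intro deep_cong1, auto)
  next
    case False
    with Ex1.prems have "deep I D E (g(u := d)) G (if u = x then \<phi> else repl1 x z \<phi>) \<longleftrightarrow>
        deep I D E (g(u := d, x := (g(u := d)) z)) G \<phi>"
      by (simp add: Ex1.IH fun_upd_def)
    also have "\<dots> \<longleftrightarrow> deep I D E (g(x := g z, u := d)) G \<phi>"
      using False Ex1.prems by (intro deep_cong1) auto
    finally show ?thesis .
  qed
  then show "deep I D E g G (repl1 x z (Ex1 u \<phi>)) \<longleftrightarrow> deep I D E (g(x := g z)) G (Ex1 u \<phi>)"
    by simp
qed auto

lemma deep_rename1:
  "w \<notin> vars1 \<phi> \<Longrightarrow> w \<noteq> z \<Longrightarrow> deep I D E g G (rename1 z w \<phi>) \<longleftrightarrow>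
      deep I D E g G \<phi>"
proof (induction \<phi> arbitrary: g G)
  case (Ex1 u \<phi>)
  \<comment> \<open>Used at a renamed binder, where \<open>u = z\<close>: the replacement passes the
    value \<open>d\<close> from \<open>w\<close> on to \<open>z\<close>, and the leftover update at
    \<open>w\<close> is harmless because \<open>w\<close> does not occur in \<phi>.\<close>
  have "deep I D E (g(w := d)) G (repl1 z w (rename1 z w \<phi>)) \<longleftrightarrow> deep I D E (g(z := d)) G \<phi>" for d
  proof -
    have "deep I D E (g(w := d)) G (repl1 z w (rename1 z w \<phi>)) \<longleftrightarrow>
        deep I D E (g(w := d, z := (g(w := d)) w)) G (rename1 z w \<phi>)"
      using Ex1.prems by (intro deep_repl1 free_for1_rename1) auto
    also have "\<dots> \<longleftrightarrow> deep I D E (g(w := d, z := (g(w := d)) w)) G \<phi>"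
      using Ex1.prems by (intro Ex1.IH) auto
    also have "\<dots> \<longleftrightarrow> deep I D E (g(z := d)) G \<phi>"
      using Ex1.prems fv1_subset_vars1[of \<phi>] by (intro deep_cong1) auto
    finally show ?thesis .
  qed
  with Ex1 show ?case by auto
qed auto

text \<open>After the renaming no binder of \<open>z\<close> is left, so the replacement by
  \<open>z\<close> captures nothing. The domains \<open>D\<close> and \<open>E\<close> are
  arbitrary: updating the assignment does not change what the quantifiers range over.\<close>

lemma deep_subst1: "deep I D E g G ([x \<leftarrow>\<^sub>r z](\<phi>)) \<longleftrightarrow> deep I D E (g(x := g z)) G \<phi>"
  using fresh1[of x z \<phi>]
  by (simp add: subst1_def deep_repl1 deep_rename1 free_for1_if_notin_binders notin_binders1_rename1)

section \<open>Set variables: the same argument with the roles of \<open>g\<close> and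
  \<open>G\<close> exchanged\<close>

primrec fv2 :: "mso \<Rightarrow> nat set" where
  "fv2 (Rel r x y) = {}"
| "fv2 (Mem X x) = {X}"
| "fv2 (Neg \<phi>) = fv2 \<phi>"
| "fv2 (Conj \<phi> \<psi>) = fv2 \<phi> \<union> fv2 \<psi>"
| "fv2 (Ex2 u \<phi>) = fv2 \<phi> - {u}"
| "fv2 (Ex1 u \<phi>) = fv2 \<phi>"

primrec binders2 :: "mso \<Rightarrow> nat set" where
  "binders2 (Rel r x y) = {}"
| "binders2 (Mem X x) = {}"
| "binders2 (Neg \<phi>) = binders2 \<phi>"
| "binders2 (Conj \<phi> \<psi>) = binders2 \<phi> \<union> binders2 \<psi>"
| "binders2 (Ex2 u \<phi>) = insert u (binders2 \<phi>)"
| "binders2 (Ex1 u \<phi>) = binders2 \<phi>"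

primrec free_for2 :: "nat \<Rightarrow> nat \<Rightarrow> mso \<Rightarrow> bool" where
  "free_for2 x z (Rel r u v) \<longleftrightarrow> True"
| "free_for2 x z (Mem X u) \<longleftrightarrow> True"
| "free_for2 x z (Neg \<phi>) \<longleftrightarrow> free_for2 x z \<phi>"
| "free_for2 x z (Conj \<phi> \<psi>) \<longleftrightarrow> free_for2 x z \<phi> \<and> free_for2 x z \<psi>"
| "free_for2 x z (Ex2 u \<phi>) \<longleftrightarrow> u = x \<or> x \<notin> fv2 \<phi> \<or> u \<noteq> z \<and> free_for2 x z \<phi>"
| "free_for2 x z (Ex1 u \<phi>) \<longleftrightarrow> free_for2 x z \<phi>"

lemma finite_vars2: "finite (vars2 \<phi>)"
  by (induction \<phi>) auto

lemma fv2_subset_vars2: "fv2 \<phi> \<subseteq> vars2 \<phi>"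
  by (induction \<phi>) auto

lemma fresh2: "fresh2 x z \<phi> \<notin> vars2 \<phi> \<and> fresh2 x z \<phi> \<noteq> x \<and> fresh2 x z \<phi> \<noteq> z"
proof -
  have "\<exists>w. w \<notin> vars2 \<phi> \<union> {x, z}"
    by (rule ex_new_if_finite) (simp_all add: finite_vars2)
  then have "\<exists>w. w \<notin> vars2 \<phi> \<and> w \<noteq> x \<and> w \<noteq> z"
    by blast
  then show ?thesis
    unfolding fresh2_def by (rule LeastI_ex)
qed

lemma repl2_notin_fv: "x \<notin> fv2 \<phi> \<Longrightarrow> repl2 x z \<phi> = \<phi>"
  by (induction \<phi>) auto

lemma fv2_repl2_subset: "fv2 (repl2 x z \<phi>) \<subseteq> insert z (fv2 \<phi> - {x})"
  by (induction \<phi>) auto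

lemma fv2_rename2_subset: "fv2 (rename2 z w \<phi>) \<subseteq> fv2 \<phi>"
proof (induction \<phi>)
  case (Ex2 u \<phi>)
  then show ?case
    using fv2_repl2_subset[of z w "rename2 z w \<phi>"] by auto
qed auto

lemma binders2_repl2 [simp]: "binders2 (repl2 x z \<phi>) = binders2 \<phi>"
  by (induction \<phi>) auto

lemma notin_binders2_rename2: "z \<noteq> w \<Longrightarrow> z \<notin> binders2 (rename2 z w \<phi>)"
  by (induction \<phi>) auto

lemma free_for2_if_notin_binders: "z \<notin> binders2 \<phi> \<Longrightarrow> free_for2 x z \<phi>"
  by (induction \<phi>) auto

text \<open>As for first-order variables, each new binder of \<open>w\<close> has a scope from which
  the replacement has removed every free \<open>z\<close>.\<close>

lemma free_for2_rename2: "w \<notin> vars2 \<phi> \<Longrightarrow> w \<noteq> z \<Longrightarrow> free_for2 z w (rename2 z w \<phi>)"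
proof (induction \<phi>)
  case (Ex2 u \<phi>)
  then show ?case
    using fv2_repl2_subset[of z w "rename2 z w \<phi>"] by auto
qed auto

lemma deep_cong2: "(\<And>v. v \<in> fv2 \<phi> \<Longrightarrow> G v = G' v) \<Longrightarrow> deep I D E g G \<phi> \<longleftrightarrow>
    deep I D E g G' \<phi>"
proof (induction \<phi> arbitrary: G G' g)
  case (Ex2 u \<phi>)
  have "deep I D E g (G(u := d)) \<phi> \<longleftrightarrow> deep I D E g (G'(u := d)) \<phi>" for d
    using Ex2.prems by (intro Ex2.IH) auto
  then show ?case by simp
next
  case (Ex1 u \<phi>)
  have "deep I D E (g(u := d)) G \<phi> \<longleftrightarrow> deep I D E (g(u := d)) G' \<phi>" for d
    using Ex1.prems by (intro Ex1.IH) auto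
  then show ?case by simp
next
  case (Conj \<phi> \<psi>)
  then show ?case by (metis UnCI deep.simps(4) fv2.simps(4))
next
  case (Neg \<phi>)
  then show ?case by (metis deep.simps(3) fv2.simps(3))
qed auto

lemma deep_repl2:
  "free_for2 x z \<phi> \<Longrightarrow> deep I D E g G (repl2 x z \<phi>) \<longleftrightarrow> deep I D E g (G(x := G z)) \<phi>"
proof (induction \<phi> arbitrary: g G)
  case (Ex2 u \<phi>)
  have "deep I D E g (G(u := d)) (if u = x then \<phi> else repl2 x z \<phi>) \<longleftrightarrow>
      deep I D E g (G(x := G z, u := d)) \<phi>" for d
  \<comment> \<open>Either the body ignores the update at \<open>x\<close>, or \<open>u\<close>
    differs from both \<open>x\<close> and \<open>z\<close> and the updates commute.\<close>
  proof (cases "u = x \<or> x \<notin> fv2 \<phi>")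
    case True
    then have "(if u = x then \<phi> else repl2 x z \<phi>) = \<phi>"
      by (auto simp: repl2_notin_fv)
    then show ?thesis
      using True by (simp only:) (intro deep_cong2, auto)
  next
    case False
    with Ex2.prems have "deep I D E g (G(u := d)) (if u = x then \<phi> else repl2 x z \<phi>) \<longleftrightarrow>
        deep I D E g (G(u := d, x := (G(u := d)) z)) \<phi>"
      by (simp add: Ex2.IH fun_upd_def)
    also have "\<dots> \<longleftrightarrow> deep I D E g (G(x := G z, u := d)) \<phi>"
      using False Ex2.prems by (intro deep_cong2) auto
    finally show ?thesis .
  qed
  then show "deep I D E g G (repl2 x z (Ex2 u \<phi>)) \<longleftrightarrow> deep I D E g (G(x := G z)) (Ex2 u \<phi>)"
    by simp
qed auto

lemma deep_rename2:
  "w \<notin> vars2 \<phi> \<Longrightarrow> w \<noteq> z \<Longrightarrow> deep I D E g G (rename2 z w \<phi>) \<longleftrightarrow>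
      deep I D E g G \<phi>"
proof (induction \<phi> arbitrary: g G)
  case (Ex2 u \<phi>)
  \<comment> \<open>Used at \<open>u = z\<close>: the set \<open>d\<close> reaches \<open>z\<close>
    through the fresh \<open>w\<close>.\<close>
  have "deep I D E g (G(w := d)) (repl2 z w (rename2 z w \<phi>)) \<longleftrightarrow> deep I D E g (G(z := d)) \<phi>" for d
  proof -
    have "deep I D E g (G(w := d)) (repl2 z w (rename2 z w \<phi>)) \<longleftrightarrow>
        deep I D E g (G(w := d, z := (G(w := d)) w)) (rename2 z w \<phi>)"
      using Ex2.prems by (intro deep_repl2 free_for2_rename2) auto
    also have "\<dots> \<longleftrightarrow> deep I D E g (G(w := d, z := (G(w := d)) w)) \<phi>"
      using Ex2.prems by (intro Ex2.IH) auto
    also have "\<dots> \<longleftrightarrow> deep I D E g (G(z := d)) \<phi>"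
      using Ex2.prems fv2_subset_vars2[of \<phi>] by (intro deep_cong2) auto
    finally show ?thesis .
  qed
  with Ex2 show ?case by auto
qed auto

lemma deep_subst2: "deep I D E g G ([x \<leftarrow>\<^sub>r\<^sub>2 z](\<phi>)) \<longleftrightarrow>
    deep I D E g (G(x := G z)) \<phi>"
  using fresh2[of x z \<phi>]
  by (simp add: subst2_def deep_repl2 deep_rename2 free_for2_if_notin_binders notin_binders2_rename2)

section \<open>Agreement of the two semantics\<close>

lemma shallow_iff_deep: "shallow II gg GG \<phi> \<longleftrightarrow> deep II (range gg) (range GG) gg GG \<phi>"
  \<comment> \<open>The induction follows the recursion of \<open>shallow\<close>, since a
    quantifier unfolds to substitution instances of its body, which need not be subformulas.\<close>
  by (induction II gg GG \<phi> rule: shallow.induct) (auto simp: deep_subst1 deep_subst2)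

theorem mainTheorem2:
  fixes \<phi> :: mso
  shows "(\<forall>(II :: 'u interp) gg GG. shallow II gg GG \<phi>) \<longleftrightarrow>
         (\<forall>(I :: 'u interp) g G. deep I (range g) (range G) g G \<phi>)"
  by (simp add: shallow_iff_deep)

end
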